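(* Let $n\ge 2$ be an integer. At every point $g\in H_n$, the tangent map $d\,\mathrm{Mult}:\mathbb{C}^n\to\mathbb{C}^n$ to the multiplier map $\mathrm{Mult}$ has rank $n-1$.
   Context: $H_n$ is the space of all monic complex polynomials $g(x)$ of degree $n$ such that the map $\mathbb{C}\to\mathbb{C}$, $z\mapsto g(z)$, has exactly $n$ fixed points; equivalently, $g(x)-x$ has no multiple roots. It is viewed as an open subset of $\mathbb{C}^n$ via the coefficients $(b_0,\dots,b_{n-1})$ of $g(x)=x^n+\sum_{i=0}^{n-1}b_ix^i$. Locally on $H_n$, order the fixed points $\beta_1,\dots,\beta_n$ of $g$ (the roots of $g(x)-x$) so that each $\beta_i$ is a smooth (holomorphic) single-valued function of the coefficients of $g$. The multiplier of the fixed point $\beta_i$ is $g'(\beta_i)$, and the locally defined multiplier map is $$\mathrm{Mult}: H_n\to\mathbb{C}^n,\quad g(x)\mapsto (g'(\beta_1),\dots,g'(\beta_n)).$$ $d\,\mathrm{Mult}$ denotes its tangent map (differential with respect to the coefficients of $g$). *)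

theory Defs
  imports "HOL-Analysis.Analysis" "HOL-Computational_Algebra.Polynomial"
begin

definition fixed_points :: "complex poly \<Rightarrow> complex set" where
  "fixed_points g = {z. poly g z = z}"

definition H :: "nat \<Rightarrow> complex poly set" where
  "H n = {g. lead_coeff g = 1 \<and> degree g = n \<and> card (fixed_points g) = n}"

text \<open>
  The space of dimension \<open>n = CARD('n)\<close> is \<open>complex ^ 'n\<close>.  As the index type \<open>'n\<close> carries no
  numbering, a bijection \<open>e\<close> from \<open>'n\<close> onto \<open>{..<CARD('n)}\<close> is used to number the coefficients:
  the coordinate with index \<open>j\<close> is the coefficient of \<open>x ^ e j\<close>.
\<close>

definition coeff_vec :: "('n::finite \<Rightarrow> nat) \<Rightarrow> complex poly \<Rightarrow> complex ^ 'n" where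
  "coeff_vec e g = (\<chi> j. coeff g (e j))"

definition monic_poly :: "('n::finite \<Rightarrow> nat) \<Rightarrow> complex ^ 'n \<Rightarrow> complex poly" where
  "monic_poly e b = monom 1 CARD('n) + (\<Sum>j\<in>UNIV. monom (b $ j) (e j))"

lemma coeff_vec_monic_poly:
  fixes b :: "complex ^ 'n::finite"
  assumes e: "bij_betw e (UNIV :: 'n set) {..<CARD('n)}"
  shows "coeff_vec e (monic_poly e b) = b"
proof -
  have "coeff (monic_poly e b) (e i) = b $ i" for i
  proof -
    have "e i < CARD('n)" using e by (auto simp: bij_betw_def)
    moreover have "e j = e i \<longleftrightarrow> j = i" for j
      using e by (auto simp: bij_betw_def inj_on_def)
    ultimately show ?thesis by (simp add: monic_poly_def coeff_sum)
  qed
  then show ?thesis by (simp add: coeff_vec_def vec_eq_iff)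
qed

lemma monic_poly_coeff_vec:
  fixes e :: "'n::finite \<Rightarrow> nat"
  assumes e: "bij_betw e (UNIV :: 'n set) {..<CARD('n)}"
    and g: "lead_coeff g = 1" "degree g = CARD('n)"
  shows "monic_poly e (coeff_vec e g) = g"
proof -
  have "(\<Sum>j\<in>UNIV. monom (coeff g (e j)) (e j)) = (\<Sum>i<CARD('n). monom (coeff g i) i)"
    by (rule sum.reindex_bij_betw[OF e])
  moreover have "g = (\<Sum>i\<le>CARD('n). monom (coeff g i) i)"
    using poly_as_sum_of_monoms[of g] g(2) by simp
  ultimately show ?thesis
    using g by (simp add: monic_poly_def coeff_vec_def lessThan_Suc_atMost[symmetric] add.commute)
qed

text \<open>
  The library has no holomorphy in several variables.  \<open>has_derivative\<close> only asks for a real-linear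
  derivative; requiring it to be given by a complex matrix makes it complex-linear.
\<close>

definition holomorphic_vec_on :: "(complex ^ 'n \<Rightarrow> complex ^ 'm) \<Rightarrow> (complex ^ 'n) set \<Rightarrow> bool" where
  "holomorphic_vec_on f U \<longleftrightarrow>
     (\<forall>b\<in>U. \<exists>A :: complex ^ 'n ^ 'm. (f has_derivative (\<lambda>h. A *v h)) (at b))"

text \<open>A local ordering \<open>\<beta>\<close> of the fixed points, defined on an open set \<open>U\<close> of coefficient vectors.\<close>

definition local_fixed_point_ordering ::
    "('n::finite \<Rightarrow> nat) \<Rightarrow> (complex ^ 'n) set \<Rightarrow> (complex ^ 'n \<Rightarrow> complex ^ 'n) \<Rightarrow> bool" where
  "local_fixed_point_ordering e U \<beta> \<longleftrightarrow>
     open U \<and>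
     (\<forall>b\<in>U. monic_poly e b \<in> H CARD('n)) \<and>
     (\<forall>b\<in>U. bij_betw (\<lambda>i. \<beta> b $ i) UNIV (fixed_points (monic_poly e b))) \<and>
     holomorphic_vec_on \<beta> U"

definition Mult ::
    "('n::finite \<Rightarrow> nat) \<Rightarrow> (complex ^ 'n \<Rightarrow> complex ^ 'n) \<Rightarrow> complex ^ 'n \<Rightarrow> complex ^ 'n" where
  "Mult e \<beta> b = (\<chi> i. poly (pderiv (monic_poly e b)) (\<beta> b $ i))"

end

theory Submission
  imports Defs
begin

text \<open>
  Let \<open>g\<close> be a point of \<open>H n\<close> with fixed points \<open>\<beta>\<^sub>1, \<dots>, \<beta>\<^sub>n\<close> and \<open>f = g - x\<close>, so that
  \<open>f = \<Prod>\<^sub>i (x - \<beta>\<^sub>i)\<close> has only simple roots.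

  A local ordering of the fixed points exists by the inverse function theorem: the map from
  \<open>(\<beta>\<^sub>1, \<dots>, \<beta>\<^sub>n)\<close> to the coefficients of \<open>\<Prod>\<^sub>i (x - \<beta>\<^sub>i) + x\<close> has an invertible complex Jacobian matrix
  wherever the \<open>\<beta>\<^sub>i\<close> are distinct (\<open>vieta_matrix_invertible\<close>, \<open>local_fixed_point_ordering_exists\<close>).

  For every local ordering, implicit differentiation of \<open>g(\<beta>\<^sub>i) = \<beta>\<^sub>i\<close> shows that, in the direction of a
  polynomial \<open>h\<close> of degree less than \<open>n\<close>, the multiplier \<open>g'(\<beta>\<^sub>i)\<close> has the derivative
  \<open>D\<^sub>i(h) = h'(\<beta>\<^sub>i) - f''(\<beta>\<^sub>i) / f'(\<beta>\<^sub>i) * h(\<beta>\<^sub>i)\<close> (\<open>has_derivative_Mult\<close>).  Since \<open>D\<^sub>i(f') = 0\<close> for all \<open>i\<close>, the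
  rank is at most \<open>n - 1\<close>.  For the lower bound, the linear relations between the rows \<open>D\<^sub>i\<close> are
  determined.  Put \<open>f\<^sub>k = f / (x - \<beta>\<^sub>k)\<close>.  Then
  \<open>D\<^sub>i(f\<^sub>k) * f'(\<beta>\<^sub>k) = - f'(\<beta>\<^sub>i) * f\<^sub>i'(\<beta>\<^sub>k)\<close> (\<open>mult_row_cofactor\<close>), so a relation
  \<open>\<Sum>\<^sub>i u\<^sub>i D\<^sub>i = 0\<close> says that the polynomial \<open>p\<close> of degree less than \<open>n\<close> with values
  \<open>p(\<beta>\<^sub>i) = u\<^sub>i f'(\<beta>\<^sub>i)\<^sup>2\<close> has a derivative that vanishes at all \<open>n\<close> points \<open>\<beta>\<^sub>k\<close>.  Hence \<open>p\<close> is
  constant, the relations form at most a line (\<open>mult_row_left_kernel\<close>), and the rank is exactly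
  \<open>n - 1\<close> (\<open>rank_mult_matrix\<close>).
\<close>

section \<open>Preliminaries on matrices and vectors\<close>

text \<open>
  The rank is the dimension of the row space, which is the image of \<open>u \<mapsto> u v* A\<close>.  As the square
  matrix \<open>A\<close> is singular, the kernel of this map is nonzero, so it is exactly the line through \<open>w\<close>.
\<close>

lemma rank_eq_card_minus_1:
  fixes A :: "'a::field ^ 'n ^ 'n"
  assumes z: "A *v z = 0" "z \<noteq> 0"
    and ker: "\<And>u. u v* A = 0 \<Longrightarrow> \<exists>c. u = c *s w"
  shows "rank A = CARD('n) - 1"
proof -
  define L where "L = (\<lambda>u. u v* A)"
  have L_transpose: "L = (*v) (transpose A)"
    by (simp add: L_def fun_eq_iff)
  have lin: "Vector_Spaces.linear (*s) (*s) L"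
    unfolding L_transpose by (rule matrix_vector_mul_linear_gen)
  have "\<not> inj L"
  proof
    assume "inj L"
    then obtain B where "B ** transpose A = mat 1"
      unfolding L_transpose using matrix_left_invertible_injective by blast
    then have "A ** transpose B = mat 1"
      by (metis matrix_transpose_mul transpose_mat transpose_transpose)
    then have "transpose B ** A = mat 1"
      by (simp add: matrix_left_right_inverse)
    then show False
      using z matrix_left_invertible_ker by blast
  qed
  then obtain u0 where u0: "u0 \<noteq> 0" "L u0 = 0"
    unfolding L_transpose using vec.inj_iff_eq_0 by blast
  then obtain i0 where i0: "u0 $ i0 \<noteq> 0"
    by (auto simp: vec_eq_iff)
  obtain c0 where c0: "u0 = c0 *s w"
    using ker u0 by (auto simp: L_def)
  with i0 have w: "w $ i0 \<noteq> 0" by auto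
  \<comment> \<open>The coordinate hyperplane \<open>u $ i0 = 0\<close> is a complement of the left kernel.\<close>
  define B where "B = (\<lambda>i. axis i 1 :: 'a ^ 'n) ` (- {i0})"
  have span_B: "vec.span B = {u. u $ i0 = 0}"
  proof (intro equalityI subsetI CollectI)
    fix u assume "u \<in> vec.span B"
    then show "u $ i0 = 0"
      by (induction rule: vec.span_induct_alt) (auto simp: B_def axis_def)
  next
    fix u :: "'a ^ 'n" assume "u \<in> {u. u $ i0 = 0}"
    then have "u $ i *s axis i 1 \<in> vec.span B" for i
      by (cases "i = i0") (auto simp: B_def intro: vec.span_scale vec.span_base vec.span_zero)
    then have "(\<Sum>i\<in>UNIV. u $ i *s axis i 1) \<in> vec.span B"
      by (intro vec.span_sum)
    then show "u \<in> vec.span B"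
      by (simp add: basis_expansion)
  qed
  have "inj_on L (vec.span B)"
  proof (subst vec.linear_inj_on_iff_eq_0[OF lin vec.subspace_span], intro ballI impI)
    fix u assume "u \<in> vec.span B" "L u = 0"
    then have "u v* A = 0" "u $ i0 = 0"
      by (simp_all add: L_def span_B)
    moreover from this ker obtain c where "u = c *s w"
      by blast
    ultimately show "u = 0"
      using w by auto
  qed
  then have "vec.dim (L ` B) = vec.dim B"
    by (rule vec.dim_image_eq[OF lin])
  also have "\<dots> = card B"
    by (rule vec.dim_eq_card_independent, rule vec.independent_mono[OF independent_cart_basis])
      (auto simp: B_def cart_basis_def)
  also have "\<dots> = CARD('n) - 1"
    unfolding B_def
    by (subst card_image) (auto simp: inj_on_def axis_eq_axis Compl_eq_Diff_UNIV)
  finally have dim: "vec.dim (L ` B) = CARD('n) - 1" .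
  have "L u \<in> L ` vec.span B" for u
  proof -
    have "L u = L (u - (u $ i0 / u0 $ i0) *s u0)"
      using u0(2) by (simp add: vec.linear_diff[OF lin] vec.linear_scale[OF lin])
    moreover have "u - (u $ i0 / u0 $ i0) *s u0 \<in> vec.span B"
      using i0 by (simp add: span_B)
    ultimately show ?thesis by blast
  qed
  then have range: "range L = vec.span (L ` B)"
    using vec.linear_span_image[OF lin, of B] by auto
  have "vec.span (rows A) = range L"
  proof (intro equalityI subsetI)
    have "row i A = L (axis i 1)" for i
      by (simp add: L_def vec_eq_iff vector_matrix_mult_def axis_def row_def if_distrib if_distribR cong: if_cong)
    then have "rows A \<subseteq> range L"
      by (auto simp: rows_def)
    then show "x \<in> range L" if "x \<in> vec.span (rows A)" for x
      using that vec.span_minimal[of "rows A" "range L"] range by auto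
  next
    fix x assume "x \<in> range L"
    then show "x \<in> vec.span (rows A)"
      using matrix_vector_mult_in_columnspace_gen[of "transpose A"]
      by (auto simp: L_transpose columns_transpose)
  qed
  with range dim show ?thesis
    by (metis row_rank_def_gen vec.dim_span)
qed

lemma linear_matrix_vector_mult_complex: "linear ((*v) (A :: complex ^ 'n ^ 'm))"
  by (rule linearI)
    (auto simp: vec_eq_iff matrix_vector_mult_def scaleR_sum_right sum.distrib algebra_simps)

lemma has_derivative_vec_componentwise:
  fixes f :: "'a::euclidean_space \<Rightarrow> 'b::euclidean_space ^ 'n"
  assumes "\<And>i. ((\<lambda>x. f x $ i) has_derivative (\<lambda>h. f' h $ i)) (at x)"
  shows "(f has_derivative f') (at x)"
  unfolding has_derivative_def
proof
  have lin: "linear (\<lambda>h. f' h $ i)" for i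
    using assms has_derivative_linear by blast
  have "linear f'"
    using linear_add[OF lin] linear_scale[OF lin] by (intro linearI) (auto simp: vec_eq_iff)
  then show "bounded_linear f'"
    by (simp add: linear_conv_bounded_linear)
  show "((\<lambda>y. (f y - f (Lim (at x) (\<lambda>x. x)) - f' (y - Lim (at x) (\<lambda>x. x))) /\<^sub>R
          norm (y - Lim (at x) (\<lambda>x. x))) \<longlongrightarrow> 0) (at x)"
    by (rule vec_tendstoI) (use assms in \<open>simp add: has_derivative_def\<close>)
qed

section \<open>Polynomials given by their roots\<close>

lemma pderiv_sum: "pderiv (sum q A) = (\<Sum>i\<in>A. pderiv (q i))"
  by (induction A rule: infinite_finite_induct) (auto simp: pderiv_add)

text \<open>
  The monic polynomial whose roots, with multiplicity, are the \<open>\<beta> $ i\<close> with \<open>i \<in> S\<close>.  For \<open>S = UNIV\<close> and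
  \<open>\<beta>\<close> the vector of fixed points of \<open>g\<close>, this is \<open>f = g - x\<close>; for \<open>S = UNIV - {k}\<close> it is the cofactor
  \<open>f / (x - \<beta> $ k)\<close>.
\<close>

definition root_poly :: "complex ^ 'n::finite \<Rightarrow> 'n set \<Rightarrow> complex poly" where
  "root_poly \<beta> S = (\<Prod>i\<in>S. [:- \<beta> $ i, 1:])"

lemma degree_root_poly: "degree (root_poly \<beta> S) = card S"
  unfolding root_poly_def by (subst degree_prod_sum_eq) auto

lemma lead_coeff_root_poly: "lead_coeff (root_poly \<beta> S) = 1"
  unfolding root_poly_def lead_coeff_prod by simp

lemma poly_root_poly_eq_0_iff: "poly (root_poly \<beta> S) x = 0 \<longleftrightarrow> (\<exists>i\<in>S. x = \<beta> $ i)"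
  by (auto simp: root_poly_def poly_prod)

lemma root_poly_remove:
  fixes \<beta> :: "complex ^ 'n::finite"
  shows "i \<in> S \<Longrightarrow> root_poly \<beta> S = [:- \<beta> $ i, 1:] * root_poly \<beta> (S - {i})"
  unfolding root_poly_def by (rule prod.remove) auto

lemma poly_pderiv_root_poly:
  "poly (pderiv (root_poly \<beta> UNIV)) (\<beta> $ i) = poly (root_poly \<beta> (UNIV - {i})) (\<beta> $ i)"
proof -
  define q where "q = root_poly \<beta> (UNIV - {i})"
  have "root_poly \<beta> UNIV = [:- \<beta> $ i, 1:] * q"
    unfolding q_def by (rule root_poly_remove) simp
  then have "poly (pderiv (root_poly \<beta> UNIV)) (\<beta> $ i) = poly q (\<beta> $ i)"
    by (simp only: pderiv_mult) (simp add: pderiv_pCons)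
  then show ?thesis
    by (simp add: q_def)
qed

lemma pderiv_root_poly_nonzero:
  assumes "inj (($) \<beta>)"
  shows "poly (pderiv (root_poly \<beta> UNIV)) (\<beta> $ i) \<noteq> 0"
  using assms by (auto simp: poly_pderiv_root_poly poly_root_poly_eq_0_iff inj_on_def)

text \<open>A polynomial of degree less than \<open>n\<close> is recovered from its coefficient vector.\<close>

lemma sum_coeff_vec_monom:
  fixes e :: "'n::finite \<Rightarrow> nat"
  assumes e: "bij_betw e UNIV {..<CARD('n)}" and h: "degree h < CARD('n)"
  shows "(\<Sum>j\<in>UNIV. smult (coeff_vec e h $ j) (monom 1 (e j))) = h"
proof -
  have "(\<Sum>j\<in>UNIV. smult (coeff_vec e h $ j) (monom 1 (e j))) = (\<Sum>j\<in>UNIV. monom (coeff h (e j)) (e j))"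
    by (simp add: coeff_vec_def smult_monom)
  also have "\<dots> = (\<Sum>i<CARD('n). monom (coeff h i) i)"
    by (rule sum.reindex_bij_betw[OF e])
  also have "\<dots> = (\<Sum>i\<le>CARD('n) - 1. monom (coeff h i) i)"
    by (rule sum.cong) (use h in auto)
  also have "\<dots> = h"
    using poly_as_sum_of_monoms'[of h "CARD('n) - 1"] h by simp
  finally show ?thesis .
qed

section \<open>The rank of the derivative of the multipliers\<close>

text \<open>
  The derivative of the \<open>i\<close>-th multiplier when the coefficients of \<open>g\<close> move in the direction of the
  polynomial \<open>h\<close>: the term \<open>h'(\<beta> $ i)\<close> comes from varying \<open>g\<close> in \<open>g'(\<beta> $ i)\<close>, and the other term from
  the fixed point moving with velocity \<open>- h(\<beta> $ i) / f'(\<beta> $ i)\<close>, where \<open>f = g - x\<close> and \<open>g'' = f''\<close>.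
\<close>

definition mult_row :: "complex ^ 'n::finite \<Rightarrow> 'n \<Rightarrow> complex poly \<Rightarrow> complex" where
  "mult_row \<beta> i h =
     (let f = root_poly \<beta> UNIV
      in poly (pderiv h) (\<beta> $ i) -
         poly (pderiv (pderiv f)) (\<beta> $ i) / poly (pderiv f) (\<beta> $ i) * poly h (\<beta> $ i))"

text \<open>
  Write \<open>f\<^sub>k = f / (x - \<beta> $ k)\<close>.  Up to sign and to row and column factors, the matrix of the \<open>i\<close>-th
  row applied to \<open>f\<^sub>k\<close> is the transpose of the matrix of differentiation, which sends the basis
  polynomial \<open>f\<^sub>i\<close> to its derivative at the point \<open>\<beta> $ k\<close>.  The factor \<open>1/2\<close> in
  \<open>f\<^sub>k'(\<beta> $ k) = f''(\<beta> $ k) / 2\<close> makes the diagonal entries agree.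
\<close>

lemma mult_row_cofactor:
  fixes \<beta> :: "complex ^ 'n::finite"
  assumes inj: "inj (($) \<beta>)"
  shows "mult_row \<beta> i (root_poly \<beta> (UNIV - {k})) * poly (pderiv (root_poly \<beta> UNIV)) (\<beta> $ k) =
         - poly (pderiv (root_poly \<beta> UNIV)) (\<beta> $ i) *
           poly (pderiv (root_poly \<beta> (UNIV - {i}))) (\<beta> $ k)"
proof -
  define f where "f = root_poly \<beta> UNIV"
  define c where "c = (\<lambda>i. root_poly \<beta> (UNIV - {i}))"
  have f: "f = [:- \<beta> $ i, 1:] * c i" for i
    unfolding f_def c_def by (rule root_poly_remove) simp
  have d1: "poly (pderiv f) x = poly (c i) x + (x - \<beta> $ i) * poly (pderiv (c i)) x" for i x
    by (subst f[of i], subst pderiv_mult) (simp add: pderiv_pCons algebra_simps)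
  have d2: "poly (pderiv (pderiv f)) (\<beta> $ i) = 2 * poly (pderiv (c i)) (\<beta> $ i)" for i
    by (subst f[of i], simp only: pderiv_mult pderiv_add) (simp add: pderiv_pCons)
  have c0: "poly (c k) (\<beta> $ i) = 0" if "i \<noteq> k" for i k
    using that by (auto simp: c_def poly_root_poly_eq_0_iff)
  have nz: "poly (pderiv f) (\<beta> $ i) \<noteq> 0" for i
    unfolding f_def by (rule pderiv_root_poly_nonzero[OF inj])
  have fold: "root_poly \<beta> (UNIV - {i}) = c i" "root_poly \<beta> UNIV = f" for i
    by (simp_all add: c_def f_def)
  show ?thesis
  proof (cases "i = k")
    case True
    then show ?thesis
      using nz[of k] d1[of "\<beta> $ k" k]
      unfolding mult_row_def Let_def fold d2 by (simp add: field_simps)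
  next
    case False
    then show ?thesis
      unfolding mult_row_def Let_def fold d1[of "\<beta> $ k" i] d1[of "\<beta> $ i" k]
      using c0[of i k] c0[of k i] by (simp add: algebra_simps)
  qed
qed

text \<open>
  A linear relation between the rows makes the derivative of \<open>p = (\<Sum>i. u\<^sub>i f'(\<beta> $ i) f\<^sub>i)\<close> vanish at every
  \<open>\<beta> $ k\<close>.  As \<open>degree p < n\<close>, this forces \<open>p\<close> to be constant, and \<open>p(\<beta> $ k) = u\<^sub>k f'(\<beta> $ k)\<^sup>2\<close>.
\<close>

lemma mult_row_left_kernel:
  fixes \<beta> :: "complex ^ 'n::finite"
  assumes inj: "inj (($) \<beta>)"
    and u: "\<And>k. (\<Sum>i\<in>UNIV. u $ i * mult_row \<beta> i (root_poly \<beta> (UNIV - {k}))) = 0"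
  shows "\<exists>c. u = c *s (\<chi> i. 1 / poly (pderiv (root_poly \<beta> UNIV)) (\<beta> $ i) ^ 2)"
proof -
  define d where "d = (\<lambda>i. poly (pderiv (root_poly \<beta> UNIV)) (\<beta> $ i))"
  define c where "c = (\<lambda>i. root_poly \<beta> (UNIV - {i}))"
  define p where "p = (\<Sum>i\<in>UNIV. smult (u $ i * d i) (c i))"
  have d: "d i \<noteq> 0" for i
    unfolding d_def by (rule pderiv_root_poly_nonzero[OF inj])
  have "poly (pderiv p) (\<beta> $ k) = 0" for k
  proof -
    have "poly (pderiv p) (\<beta> $ k) = (\<Sum>i\<in>UNIV. u $ i * (d i * poly (pderiv (c i)) (\<beta> $ k)))"
      by (simp add: p_def pderiv_sum pderiv_smult poly_sum mult.assoc)
    also have "\<dots> = (\<Sum>i\<in>UNIV. u $ i * - (mult_row \<beta> i (c k) * d k))"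
      using mult_row_cofactor[OF inj] by (simp add: c_def d_def)
    also have "\<dots> = - d k * (\<Sum>i\<in>UNIV. u $ i * mult_row \<beta> i (c k))"
      by (simp add: sum_distrib_left sum_negf mult_ac)
    finally show ?thesis using u[of k] by (simp add: c_def)
  qed
  have card: "card (range (($) \<beta>)) = CARD('n)"
    using inj by (rule card_image)
  have deg: "degree p \<le> CARD('n) - 1"
    unfolding p_def c_def
    by (rule degree_sum_le) (auto simp: degree_root_poly intro!: order_trans[OF degree_smult_le])
  then have "degree (pderiv p) < CARD('n)"
    using zero_less_card_finite[where 'a = 'n] unfolding degree_pderiv by linarith
  have "pderiv p = 0"
    by (rule poly_eqI_degree[where A = "range (($) \<beta>)"])
      (use \<open>\<And>k. poly (pderiv p) (\<beta> $ k) = 0\<close> \<open>degree (pderiv p) < CARD('n)\<close> in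
        \<open>auto simp: card\<close>)
  then have "degree p = 0"
    by (simp add: pderiv_eq_0_iff)
  then obtain a where a: "p = [:a:]"
    by (rule degree_eq_zeroE)
  have "u $ k * d k ^ 2 = a" for k
  proof -
    have "poly (c i) (\<beta> $ k) = 0" if "i \<noteq> k" for i
      using that by (auto simp: c_def poly_root_poly_eq_0_iff)
    then have "poly p (\<beta> $ k) = (\<Sum>i\<in>{k}. u $ i * d i * poly (c i) (\<beta> $ k))"
      unfolding p_def poly_sum by (intro sum.mono_neutral_cong_right) auto
    moreover have "poly (c k) (\<beta> $ k) = d k"
      by (simp add: c_def d_def poly_pderiv_root_poly)
    ultimately show ?thesis
      by (simp add: a power2_eq_square mult.assoc)
  qed
  then have "u = a *s (\<chi> i. 1 / d i ^ 2)"
    using d by (auto simp: vec_eq_iff field_simps)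
  then show ?thesis unfolding d_def ..
qed

text \<open>The matrix of \<open>mult_row\<close> in the coordinates given by the coefficients of \<open>h\<close>, numbered by \<open>e\<close>.\<close>

definition mult_matrix :: "('n::finite \<Rightarrow> nat) \<Rightarrow> complex ^ 'n \<Rightarrow> complex ^ 'n ^ 'n" where
  "mult_matrix e \<beta> = (\<chi> i j. mult_row \<beta> i (monom 1 (e j)))"

lemma mult_row_sum:
  "mult_row \<beta> i (\<Sum>j\<in>A. smult (a j) (q j)) = (\<Sum>j\<in>A. a j * mult_row \<beta> i (q j))"
  by (simp add: mult_row_def Let_def pderiv_sum pderiv_smult poly_sum sum_distrib_left
      sum_divide_distrib sum_subtractf algebra_simps)

lemma mult_matrix_mult:
  "(mult_matrix e \<beta> *v h) $ i = mult_row \<beta> i (\<Sum>j\<in>UNIV. smult (h $ j) (monom 1 (e j)))"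
  by (simp add: mult_matrix_def matrix_vector_mult_def mult_row_sum mult.commute)

theorem rank_mult_matrix:
  fixes e :: "'n::finite \<Rightarrow> nat"
  assumes e: "bij_betw e UNIV {..<CARD('n)}" and inj: "inj (($) \<beta>)"
  shows "rank (mult_matrix e \<beta>) = CARD('n) - 1"
proof (rule rank_eq_card_minus_1)
  define f where "f = root_poly \<beta> UNIV"
  have deg: "degree (pderiv f) < CARD('n)"
    by (simp add: f_def degree_pderiv degree_root_poly)
  have "pderiv f \<noteq> 0"
    using pderiv_root_poly_nonzero[OF inj] by (auto simp: f_def)
  then show "coeff_vec e (pderiv f) \<noteq> 0"
    using sum_coeff_vec_monom[OF e deg] by auto
  \<comment> \<open>The direction \<open>f'\<close> is the translation of all fixed points, which leaves the multipliers unchanged.\<close>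
  have "mult_row \<beta> i (pderiv f) = 0" for i
    using pderiv_root_poly_nonzero[OF inj, of i] by (simp add: mult_row_def f_def)
  then show "mult_matrix e \<beta> *v coeff_vec e (pderiv f) = 0"
    by (simp add: vec_eq_iff mult_matrix_mult sum_coeff_vec_monom[OF e deg])
next
  fix u assume u: "u v* mult_matrix e \<beta> = 0"
  have "(\<Sum>i\<in>UNIV. u $ i * mult_row \<beta> i (root_poly \<beta> (UNIV - {k}))) = 0" for k
  proof -
    define h where "h = root_poly \<beta> (UNIV - {k})"
    have "degree h < CARD('n)"
      by (simp add: h_def degree_root_poly)
    then have "(\<Sum>i\<in>UNIV. u $ i * mult_row \<beta> i h) =
        (\<Sum>i\<in>UNIV. u $ i * (mult_matrix e \<beta> *v coeff_vec e h) $ i)"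
      by (simp add: mult_matrix_mult sum_coeff_vec_monom[OF e])
    also have "\<dots> = (\<Sum>j\<in>UNIV. (u v* mult_matrix e \<beta>) $ j * coeff_vec e h $ j)"
      unfolding matrix_vector_mult_def vector_matrix_mult_def
      by (simp add: sum_distrib_left sum_distrib_right mult_ac) (rule sum.swap)
    finally show ?thesis by (simp add: u h_def)
  qed
  then show "\<exists>c. u = c *s (\<chi> i. 1 / poly (pderiv (root_poly \<beta> UNIV)) (\<beta> $ i) ^ 2)"
    by (rule mult_row_left_kernel[OF inj])
qed

section \<open>Existence of a local ordering of the fixed points\<close>

text \<open>The polynomial whose fixed points are the entries of \<open>\<beta>\<close>.\<close>

definition fix_poly :: "complex ^ 'n::finite \<Rightarrow> complex poly" where
  "fix_poly \<beta> = root_poly \<beta> UNIV + [:0, 1:]"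

text \<open>
  The Jacobian matrix of the map that sends \<open>\<beta>\<close> to the coefficient vector of \<open>fix_poly \<beta>\<close>: the
  derivative of \<open>root_poly \<beta> UNIV\<close> with respect to \<open>\<beta> $ i\<close> is \<open>- root_poly \<beta> (UNIV - {i})\<close>.
\<close>

definition vieta_matrix :: "('n::finite \<Rightarrow> nat) \<Rightarrow> complex ^ 'n \<Rightarrow> complex ^ 'n ^ 'n" where
  "vieta_matrix e \<beta> = (\<chi> j i. - coeff (root_poly \<beta> (UNIV - {i})) (e j))"

lemma has_derivative_coeff_root_poly:
  "((\<lambda>\<beta>. coeff (root_poly \<beta> S) m) has_derivative
     (\<lambda>h. \<Sum>i\<in>S. - (h $ i) * coeff (root_poly \<beta> (S - {i})) m)) (at \<beta>)"
proof (induction S arbitrary: m rule: infinite_finite_induct)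
  case (insert k S)
  have fac: "root_poly x (insert k T) = [:- x $ k, 1:] * root_poly x T" if "k \<notin> T" for x :: "complex ^ 'a" and T
    using that by (simp add: root_poly_def)
  \<comment> \<open>The case distinction stands for the coefficient of index \<open>m - 1\<close>, which is \<open>0\<close> if \<open>m = 0\<close>.\<close>
  have coeff: "coeff ([:- a, 1:] * q) m = - a * coeff q m + (case m of 0 \<Rightarrow> 0 | Suc l \<Rightarrow> coeff q l)"
    for a :: complex and q by (cases m) auto
  have nth: "((\<lambda>x. x $ k) has_derivative (\<lambda>h. h $ k)) (at \<beta>)"
    by (rule bounded_linear_imp_has_derivative[OF bounded_linear_vec_nth])
  have prev: "((\<lambda>\<beta>. case m of 0 \<Rightarrow> 0 | Suc l \<Rightarrow> coeff (root_poly \<beta> S) l) has_derivative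
       (\<lambda>h. \<Sum>i\<in>S. - (h $ i) * (case m of 0 \<Rightarrow> 0 | Suc l \<Rightarrow> coeff (root_poly \<beta> (S - {i})) l))) (at \<beta>)"
    by (cases m) (use insert.IH in \<open>auto\<close>)
  have "((\<lambda>\<beta>. coeff (root_poly \<beta> (insert k S)) m) has_derivative
     (\<lambda>h. (- (\<beta> $ k) * (\<Sum>i\<in>S. - (h $ i) * coeff (root_poly \<beta> (S - {i})) m)
            + - (h $ k) * coeff (root_poly \<beta> S) m) +
         (\<Sum>i\<in>S. - (h $ i) * (case m of 0 \<Rightarrow> 0 | Suc l \<Rightarrow> coeff (root_poly \<beta> (S - {i})) l)))) (at \<beta>)"
    unfolding fac[OF insert.hyps(2)] coeff
    by (intro has_derivative_add has_derivative_mult has_derivative_minus nth insert.IH prev)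
  also have "(\<lambda>h. (- (\<beta> $ k) * (\<Sum>i\<in>S. - (h $ i) * coeff (root_poly \<beta> (S - {i})) m)
            + - (h $ k) * coeff (root_poly \<beta> S) m) +
         (\<Sum>i\<in>S. - (h $ i) * (case m of 0 \<Rightarrow> 0 | Suc l \<Rightarrow> coeff (root_poly \<beta> (S - {i})) l))) =
     (\<lambda>h. \<Sum>i\<in>insert k S. - (h $ i) * coeff (root_poly \<beta> (insert k S - {i})) m)"
  proof
    fix h :: "complex ^ 'a"
    have "coeff (root_poly \<beta> (insert k S - {i})) m = - \<beta> $ k * coeff (root_poly \<beta> (S - {i})) m
            + (case m of 0 \<Rightarrow> 0 | Suc l \<Rightarrow> coeff (root_poly \<beta> (S - {i})) l)" if "i \<in> S" for i
    proof -
      have "insert k S - {i} = insert k (S - {i})"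
        using that insert.hyps by auto
      moreover have "root_poly \<beta> (insert k (S - {i})) = [:- \<beta> $ k, 1:] * root_poly \<beta> (S - {i})"
        by (rule fac) (use insert.hyps in simp)
      ultimately show ?thesis
        by (simp only: coeff)
    qed
    then have "(\<Sum>i\<in>S. - (h $ i) * coeff (root_poly \<beta> (insert k S - {i})) m) =
        (\<Sum>i\<in>S. - (h $ i) * (- \<beta> $ k * coeff (root_poly \<beta> (S - {i})) m
            + (case m of 0 \<Rightarrow> 0 | Suc l \<Rightarrow> coeff (root_poly \<beta> (S - {i})) l)))"
      by (intro sum.cong) simp_all
    also have "\<dots> = - (\<beta> $ k) * (\<Sum>i\<in>S. - (h $ i) * coeff (root_poly \<beta> (S - {i})) m) +
        (\<Sum>i\<in>S. - (h $ i) * (case m of 0 \<Rightarrow> 0 | Suc l \<Rightarrow> coeff (root_poly \<beta> (S - {i})) l))"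
      unfolding sum_distrib_left sum.distrib[symmetric] by (intro sum.cong) (simp_all add: algebra_simps)
    finally have "(\<Sum>i\<in>S. - (h $ i) * coeff (root_poly \<beta> (insert k S - {i})) m) = \<dots>" .
    then show "(- (\<beta> $ k) * (\<Sum>i\<in>S. - (h $ i) * coeff (root_poly \<beta> (S - {i})) m)
            + - (h $ k) * coeff (root_poly \<beta> S) m) +
         (\<Sum>i\<in>S. - (h $ i) * (case m of 0 \<Rightarrow> 0 | Suc l \<Rightarrow> coeff (root_poly \<beta> (S - {i})) l)) =
        (\<Sum>i\<in>insert k S. - (h $ i) * coeff (root_poly \<beta> (insert k S - {i})) m)"
      using insert.hyps by simp
  qed
  finally show ?case .
qed (auto simp: root_poly_def)

lemma continuous_on_coeff_root_poly: "continuous_on A (\<lambda>\<beta>. coeff (root_poly \<beta> S) m)"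
  using has_derivative_coeff_root_poly has_derivative_continuous
  by (blast intro: continuous_at_imp_continuous_on)

lemma has_derivative_vieta:
  "((\<lambda>\<beta>. coeff_vec e (fix_poly \<beta>)) has_derivative (*v) (vieta_matrix e \<beta>)) (at \<beta>)"
proof (rule has_derivative_vec_componentwise)
  fix j
  show "((\<lambda>\<beta>. coeff_vec e (fix_poly \<beta>) $ j) has_derivative (\<lambda>h. (vieta_matrix e \<beta> *v h) $ j)) (at \<beta>)"
    using has_derivative_add[OF has_derivative_coeff_root_poly[where S = UNIV and m = "e j"]
        has_derivative_const[of "coeff [:0, 1:] (e j)"]]
    by (simp add: coeff_vec_def fix_poly_def vieta_matrix_def matrix_vector_mult_def mult.commute)
qed

text \<open>
  A kernel vector \<open>h\<close> gives \<open>(\<Sum>i. h\<^sub>i f\<^sub>i) = 0\<close>, with \<open>f\<^sub>i\<close> the cofactors of distinct roots, and evaluation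
  at \<open>\<beta> $ k\<close> leaves only the term \<open>h\<^sub>k f\<^sub>k(\<beta> $ k)\<close>.
\<close>

lemma vieta_matrix_invertible:
  fixes e :: "'n::finite \<Rightarrow> nat"
  assumes e: "bij_betw e UNIV {..<CARD('n)}" and inj: "inj (($) \<beta>)"
  obtains B where "B ** vieta_matrix e \<beta> = mat 1" "vieta_matrix e \<beta> ** B = mat 1"
proof -
  have "h = 0" if h: "vieta_matrix e \<beta> *v h = 0" for h
  proof -
    define q where "q = (\<Sum>i\<in>UNIV. smult (h $ i) (root_poly \<beta> (UNIV - {i})))"
    have "degree q \<le> CARD('n) - 1"
      unfolding q_def
      by (rule degree_sum_le) (auto simp: degree_root_poly intro!: order_trans[OF degree_smult_le])
    then have deg: "degree q < CARD('n)"
      using zero_less_card_finite[where 'a = 'n] by linarith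
    have "coeff_vec e q = - (vieta_matrix e \<beta> *v h)"
      by (simp add: vec_eq_iff coeff_vec_def q_def coeff_sum vieta_matrix_def
          matrix_vector_mult_def sum_negf mult.commute)
    with h have "q = 0"
      using sum_coeff_vec_monom[OF e deg] by simp
    have "h $ k = 0" for k
    proof -
      have "0 = poly q (\<beta> $ k)" using \<open>q = 0\<close> by simp
      also have "\<dots> = (\<Sum>i\<in>{k}. h $ i * poly (root_poly \<beta> (UNIV - {i})) (\<beta> $ k))"
        unfolding q_def poly_sum poly_smult
        by (intro sum.mono_neutral_right) (auto simp: poly_root_poly_eq_0_iff)
      finally show ?thesis
        using pderiv_root_poly_nonzero[OF inj, of k] by (simp add: poly_pderiv_root_poly)
    qed
    then show ?thesis by (simp add: vec_eq_iff)
  qed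
  then obtain B where "B ** vieta_matrix e \<beta> = mat 1"
    using matrix_left_invertible_ker by blast
  then show ?thesis
    using that matrix_left_right_inverse by blast
qed

lemma open_inj_vec: "open {\<beta> :: complex ^ 'n::finite. inj (($) \<beta>)}"
proof -
  have "{\<beta> :: complex ^ 'n. inj (($) \<beta>)} = (\<Inter>(i, j)\<in>{(i, j). i \<noteq> j}. {\<beta>. \<beta> $ i \<noteq> \<beta> $ j})"
    by (auto simp: inj_on_def)
  also have "open \<dots>"
    by (intro open_INT) (auto intro!: open_Collect_neq continuous_intros)
  finally show ?thesis .
qed

text \<open>The bound \<open>n \<ge> 2\<close> keeps the summand \<open>x\<close> of \<open>fix_poly \<beta>\<close> away from the leading term.\<close>

lemma fix_poly_properties:
  fixes \<beta> :: "complex ^ 'n::finite"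
  assumes n: "CARD('n) \<ge> 2"
  shows degree_fix_poly: "degree (fix_poly \<beta>) = CARD('n)"
    and lead_coeff_fix_poly: "lead_coeff (fix_poly \<beta>) = 1"
    and fixed_points_fix_poly: "fixed_points (fix_poly \<beta>) = range (($) \<beta>)"
proof -
  show deg: "degree (fix_poly \<beta>) = CARD('n)"
    unfolding fix_poly_def using n by (subst degree_add_eq_left) (auto simp: degree_root_poly)
  show "lead_coeff (fix_poly \<beta>) = 1"
    using lead_coeff_root_poly[of \<beta> UNIV] n
    unfolding deg by (simp add: fix_poly_def degree_root_poly coeff_eq_0)
  show "fixed_points (fix_poly \<beta>) = range (($) \<beta>)"
    using poly_root_poly_eq_0_iff[of \<beta> UNIV] by (auto simp: fixed_points_def fix_poly_def)
qed

lemma fix_poly_unique: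
  fixes \<beta> :: "complex ^ 'n::finite"
  assumes n: "CARD('n) \<ge> 2" and g: "g \<in> H CARD('n)"
    and bij: "bij_betw (($) \<beta>) UNIV (fixed_points g)"
  shows "g = fix_poly \<beta>"
proof (rule poly_eqI_degree_lead_coeff)
  show "card (fixed_points g) \<ge> CARD('n)"
    using g by (simp add: H_def)
  show "poly g z = poly (fix_poly \<beta>) z" if "z \<in> fixed_points g" for z
  proof -
    have "z \<in> fixed_points (fix_poly \<beta>)"
      using that fixed_points_fix_poly[OF n, of \<beta>] bij_betw_imp_surj_on[OF bij] by simp
    with that show ?thesis
      by (simp add: fixed_points_def)
  qed
qed (use g degree_fix_poly[OF n, of \<beta>] lead_coeff_fix_poly[OF n, of \<beta>] in \<open>auto simp: H_def\<close>)

text \<open>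
  The inverse function theorem is applied on the open set of vectors with distinct entries; the local
  inverse of the map from fixed points to coefficients is the required ordering.
\<close>

theorem local_fixed_point_ordering_exists:
  fixes e :: "'n::finite \<Rightarrow> nat"
  assumes n: "CARD('n) \<ge> 2" and e: "bij_betw e UNIV {..<CARD('n)}" and g: "g \<in> H CARD('n)"
  shows "\<exists>U \<beta>. coeff_vec e g \<in> U \<and> local_fixed_point_ordering e U \<beta>"
proof -
  let ?V = "\<lambda>\<beta> :: complex ^ 'n. coeff_vec e (fix_poly \<beta>)"
  define V' where "V' = (\<lambda>\<beta>. Blinfun ((*v) (vieta_matrix e \<beta>)))"
  have blinfun: "blinfun_apply (Blinfun ((*v) A)) = (*v) A" for A :: "complex ^ 'n ^ 'n"
    by (rule bounded_linear_Blinfun_apply)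
      (simp add: linear_matrix_vector_mult_complex flip: linear_conv_bounded_linear)
  have card: "card (fixed_points g) = CARD('n)"
    using g by (simp add: H_def)
  then have "finite (fixed_points g)"
    by (rule_tac card_ge_0_finite) simp
  then obtain b where b: "bij_betw b (UNIV :: 'n set) (fixed_points g)"
    using finite_same_card_bij[of "UNIV :: 'n set" "fixed_points g"] card by auto
  define \<beta>0 :: "complex ^ 'n" where "\<beta>0 = (\<chi> i. b i)"
  have \<beta>0: "($) \<beta>0 = b" by (auto simp: \<beta>0_def)
  have g_eq: "g = fix_poly \<beta>0"
    by (rule fix_poly_unique[OF n g]) (simp add: \<beta>0 b)
  have inj0: "inj (($) \<beta>0)"
    using b by (simp add: \<beta>0 bij_betw_def)
  obtain B where B: "B ** vieta_matrix e \<beta>0 = mat 1"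
    using vieta_matrix_invertible[OF e inj0] by blast
  have cont: "continuous_on {\<beta>. inj (($) \<beta>)} V'"
  proof (rule continuous_on_blinfun_componentwise)
    fix h :: "complex ^ 'n"
    show "continuous_on {\<beta>. inj (($) \<beta>)} (\<lambda>\<beta>. V' \<beta> h)"
      unfolding V'_def blinfun matrix_vector_mult_def vieta_matrix_def
      by (auto intro!: continuous_intros continuous_on_coeff_root_poly)
  qed
  have V_deriv: "(?V has_derivative blinfun_apply (V' \<beta>)) (at \<beta>)" for \<beta>
    unfolding V'_def blinfun by (rule has_derivative_vieta)
  have left_inv: "Blinfun ((*v) B) o\<^sub>L V' \<beta>0 = id_blinfun"
    by (rule blinfun_eqI) (simp add: V'_def blinfun matrix_vector_mul_assoc B)
  obtain U' U \<beta> \<beta>' where U: "open U'" "U' \<subseteq> {\<beta>. inj (($) \<beta>)}" "\<beta>0 \<in> U'" "open U" "?V \<beta>0 \<in> U"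
    "homeomorphism U' U ?V \<beta>"
    and deriv: "\<And>y. y \<in> U \<Longrightarrow> (\<beta> has_derivative (\<beta>' y)) (at y)"
      "\<And>y. y \<in> U \<Longrightarrow> \<beta>' y = inv (blinfun_apply (V' (\<beta> y)))"
      "\<And>y. y \<in> U \<Longrightarrow> bij (blinfun_apply (V' (\<beta> y)))"
  proof (rule inverse_function_theorem[OF open_inj_vec V_deriv cont _ left_inv])
    show "\<beta>0 \<in> {\<beta>. inj (($) \<beta>)}"
      using inj0 by simp
  qed (rule that)
  have inj: "inj (($) (\<beta> y))" and V: "?V (\<beta> y) = y" if "y \<in> U" for y
    using that U unfolding homeomorphism_def by auto
  have monic: "monic_poly e y = fix_poly (\<beta> y)" if "y \<in> U" for y
    using monic_poly_coeff_vec[OF e lead_coeff_fix_poly[OF n] degree_fix_poly[OF n]] V[OF that]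
    by metis
  have "local_fixed_point_ordering e U \<beta>"
    unfolding local_fixed_point_ordering_def
  proof (intro conjI ballI)
    fix y assume y: "y \<in> U"
    show "bij_betw (\<lambda>i. \<beta> y $ i) UNIV (fixed_points (monic_poly e y))"
      using inj[OF y] by (simp add: monic[OF y] fixed_points_fix_poly[OF n] bij_betw_def)
    show "monic_poly e y \<in> H CARD('n)"
      using inj[OF y] degree_fix_poly[OF n, of "\<beta> y"] lead_coeff_fix_poly[OF n, of "\<beta> y"]
      by (simp add: monic[OF y] fixed_points_fix_poly[OF n] H_def card_image)
  next
    show "holomorphic_vec_on \<beta> U"
      unfolding holomorphic_vec_on_def
    proof
      fix y assume y: "y \<in> U"
      \<comment> \<open>The inverse function theorem gives a real-linear derivative; it is complex-linear because it
        inverts a complex matrix.\<close>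
      obtain A where A: "A ** vieta_matrix e (\<beta> y) = mat 1" "vieta_matrix e (\<beta> y) ** A = mat 1"
        using vieta_matrix_invertible[OF e inj[OF y]] .
      have "inv (blinfun_apply (V' (\<beta> y))) = (*v) A"
        unfolding V'_def blinfun by (rule inv_equality) (simp_all add: matrix_vector_mul_assoc A)
      then show "\<exists>A. (\<beta> has_derivative (*v) A) (at y)"
        using deriv[OF y] by auto
    qed
  qed (rule U)
  then show ?thesis
    using U(5) g_eq by blast
qed

section \<open>The derivative of the multiplier map\<close>

text \<open>
  The chain rule for the evaluation of a polynomial that depends affinely on \<open>b\<close> at a point \<open>\<phi> b\<close>.
\<close>

lemma has_derivative_poly_affine:
  fixes r :: "'n::finite \<Rightarrow> complex poly"
  assumes \<phi>: "(\<phi> has_derivative \<phi>') (at b)"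
  shows "((\<lambda>b. poly (c + (\<Sum>j\<in>UNIV. smult (b $ j) (r j))) (\<phi> b)) has_derivative
     (\<lambda>h. poly (\<Sum>j\<in>UNIV. smult (h $ j) (r j)) (\<phi> b) +
          poly (pderiv (c + (\<Sum>j\<in>UNIV. smult (b $ j) (r j)))) (\<phi> b) * \<phi>' h)) (at b)"
proof -
  have p: "((\<lambda>b. poly q (\<phi> b)) has_derivative (\<lambda>h. poly (pderiv q) (\<phi> b) * \<phi>' h)) (at b)" for q
    by (rule has_derivative_compose[OF \<phi>]) (use poly_DERIV[of q "\<phi> b"] in \<open>simp add: has_field_derivative_def\<close>)
  have nth: "((\<lambda>x. x $ k) has_derivative (\<lambda>h. h $ k)) (at b)" for k
    by (rule bounded_linear_imp_has_derivative[OF bounded_linear_vec_nth])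
  have "((\<lambda>b. poly c (\<phi> b) + (\<Sum>j\<in>UNIV. b $ j * poly (r j) (\<phi> b))) has_derivative
    (\<lambda>h. poly (pderiv c) (\<phi> b) * \<phi>' h +
         (\<Sum>j\<in>UNIV. b $ j * (poly (pderiv (r j)) (\<phi> b) * \<phi>' h) + h $ j * poly (r j) (\<phi> b)))) (at b)"
    by (intro has_derivative_add has_derivative_sum has_derivative_mult p nth)
  then show ?thesis
    by (simp add: poly_sum pderiv_sum pderiv_add pderiv_smult sum.distrib sum_distrib_left
        sum_distrib_right algebra_simps)
qed

theorem has_derivative_Mult:
  fixes e :: "'n::finite \<Rightarrow> nat"
  assumes n: "CARD('n) \<ge> 2"
    and ord: "local_fixed_point_ordering e U \<beta>" and b: "b \<in> U"
  shows "(Mult e \<beta> has_derivative (*v) (mult_matrix e (\<beta> b))) (at b)"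
proof (rule has_derivative_vec_componentwise)
  fix i
  note ord = ord[unfolded local_fixed_point_ordering_def]
  define f where "f = root_poly (\<beta> b) UNIV"
  define P where "P = (\<lambda>h :: complex ^ 'n. \<Sum>j\<in>UNIV. smult (h $ j) (monom 1 (e j)))"
  have fixed: "monic_poly e y \<in> H CARD('n)"
      "bij_betw (($) (\<beta> y)) UNIV (fixed_points (monic_poly e y))" if "y \<in> U" for y
    using ord that by auto
  have f: "monic_poly e b = f + [:0, 1:]"
    using fix_poly_unique[OF n fixed[OF b]] by (simp add: f_def fix_poly_def)
  have "inj (($) (\<beta> b))"
    using fixed(2)[OF b] by (simp add: bij_betw_def)
  then have nz: "poly (pderiv f) (\<beta> b $ i) \<noteq> 0"
    unfolding f_def by (rule pderiv_root_poly_nonzero)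
  obtain A where "(\<beta> has_derivative (*v) A) (at b)"
    using ord b by (auto simp: holomorphic_vec_on_def)
  then have \<beta>i: "((\<lambda>y. \<beta> y $ i) has_derivative (\<lambda>h. (A *v h) $ i)) (at b)"
    by (rule bounded_linear.has_derivative[OF bounded_linear_vec_nth])
  have monic: "monic_poly e y = monom 1 CARD('n) + P y" for y
    by (simp add: monic_poly_def P_def smult_monom)
  \<comment> \<open>Differentiating \<open>g(\<beta> $ i) - \<beta> $ i = 0\<close> determines the derivative of \<open>\<beta> $ i\<close>.\<close>
  have deriv: "((\<lambda>y. poly (monom 1 CARD('n) - [:0, 1:] + P y) (\<beta> y $ i)) has_derivative
      (\<lambda>h. poly (P h) (\<beta> b $ i) +
        poly (pderiv (monom 1 CARD('n) - [:0, 1:] + P b)) (\<beta> b $ i) * (A *v h) $ i)) (at b)"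
    unfolding P_def by (rule has_derivative_poly_affine[OF \<beta>i])
  have f': "monom 1 CARD('n) - [:0, 1:] + P b = f"
    using f monic[of b] by (simp add: algebra_simps)
  have "((\<lambda>y. poly (monom 1 CARD('n) - [:0, 1:] + P y) (\<beta> y $ i)) has_derivative (\<lambda>h. 0)) (at b)"
  proof (rule has_derivative_transform_within_open[OF has_derivative_const])
    show "open U" "b \<in> U" using ord b by auto
    fix y assume y: "y \<in> U"
    then have "\<beta> y $ i \<in> fixed_points (monic_poly e y)"
      using fixed(2)[OF y] by (auto simp: bij_betw_def)
    then show "0 = poly (monom 1 CARD('n) - [:0, 1:] + P y) (\<beta> y $ i)"
      by (simp add: fixed_points_def monic algebra_simps)
  qed
  with deriv[unfolded f'] have "(\<lambda>h. poly (P h) (\<beta> b $ i) + poly (pderiv f) (\<beta> b $ i) * (A *v h) $ i) = (\<lambda>h. 0)"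
    by (rule has_derivative_unique)
  then have A: "(A *v h) $ i = - poly (P h) (\<beta> b $ i) / poly (pderiv f) (\<beta> b $ i)" for h
    using nz by (simp add: fun_eq_iff field_simps eq_neg_iff_add_eq_0)
  have P': "pderiv (P h) = (\<Sum>j\<in>UNIV. smult (h $ j) (pderiv (monom 1 (e j))))" for h
    by (simp add: P_def pderiv_sum pderiv_smult)
  have deriv2: "((\<lambda>y. poly (pderiv (monom 1 CARD('n)) + pderiv (P y)) (\<beta> y $ i)) has_derivative
      (\<lambda>h. poly (pderiv (P h)) (\<beta> b $ i) +
        poly (pderiv (pderiv (monom 1 CARD('n)) + pderiv (P b))) (\<beta> b $ i) * (A *v h) $ i)) (at b)"
    unfolding P' by (rule has_derivative_poly_affine[OF \<beta>i])
  have f'': "pderiv (pderiv (monom 1 CARD('n)) + pderiv (P b)) = pderiv (pderiv f)"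
    using f unfolding pderiv_add[symmetric] monic[of b, symmetric]
    by (simp add: pderiv_add pderiv_pCons)
  have val: "poly (pderiv (P h)) (\<beta> b $ i) + poly (pderiv (pderiv f)) (\<beta> b $ i) * (A *v h) $ i
      = (mult_matrix e (\<beta> b) *v h) $ i" for h
    by (simp add: A mult_matrix_mult mult_row_def Let_def P_def f_def)
  show "((\<lambda>y. Mult e \<beta> y $ i) has_derivative (\<lambda>h. (mult_matrix e (\<beta> b) *v h) $ i)) (at b)"
    using deriv2 unfolding f'' val by (simp add: Mult_def monic pderiv_add)
qed

theorem corollary1p3:
  fixes n :: nat and e :: "'n::finite \<Rightarrow> nat" and g :: "complex poly"
  assumes "n \<ge> 2"
    and "CARD('n) = n"
    and "bij_betw e (UNIV :: 'n set) {..<n}"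
    and "g \<in> H n"
  shows "(\<exists>U \<beta>. coeff_vec e g \<in> U \<and> local_fixed_point_ordering e U \<beta>) \<and>
         (\<forall>U \<beta>. coeff_vec e g \<in> U \<and> local_fixed_point_ordering e U \<beta> \<longrightarrow>
            (\<exists>D :: complex ^ 'n ^ 'n.
               (Mult e \<beta> has_derivative (\<lambda>h. D *v h)) (at (coeff_vec e g)) \<and>
               rank D = n - 1))"
proof (intro conjI allI impI)
  have n: "CARD('n) \<ge> 2" and e: "bij_betw e UNIV {..<CARD('n)}" and g: "g \<in> H CARD('n)"
    using assms by simp_all
  show "\<exists>U \<beta>. coeff_vec e g \<in> U \<and> local_fixed_point_ordering e U \<beta>"
    by (rule local_fixed_point_ordering_exists[OF n e g])
  fix U \<beta> assume "coeff_vec e g \<in> U \<and> local_fixed_point_ordering e U \<beta>"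
  then have U: "coeff_vec e g \<in> U" and ord: "local_fixed_point_ordering e U \<beta>"
    by auto
  have inj: "inj (($) (\<beta> (coeff_vec e g)))"
    using U ord by (auto simp: local_fixed_point_ordering_def bij_betw_def)
  show "\<exists>D :: complex ^ 'n ^ 'n.
      (Mult e \<beta> has_derivative (\<lambda>h. D *v h)) (at (coeff_vec e g)) \<and> rank D = n - 1"
    using has_derivative_Mult[OF n ord U] rank_mult_matrix[OF e inj] assms(2) by blast
qed

end
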